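(* Let $G$ be a $3$-chromatic Eulerian triangulation of a closed surface. If $c_{4,2}(G)=0$, i.e. every vertex of $G$ has degree divisible by $4$, then Bob wins the feedback game on $G$ for every choice of starting vertex.
   Context: All graphs are finite, simple and undirected. A graph is Eulerian if every vertex has even degree. A triangulation of a closed surface (compact 2-manifold without boundary) is a graph embedded on the surface such that every face is a triangle and any two faces share at most one edge. $c_{n,k}(G)$ denotes the number of vertices of $G$ whose degree is congruent to $k$ modulo $n$. The feedback game on a connected graph $G$ with a starting vertex $s$: a token is placed on $s$; two players, Alice (who moves first) and Bob, alternately move the token from its current vertex $u$ to a vertex $v$ adjacent to $u$, and the edge $uv$ is then deleted. The first player who moves the token back to $s$, or to a vertex that is isolated after deletion of the edge just used, wins. "X wins the game" means X has a winning strategy. *)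

theory Defs
  imports "HOL-Analysis.Analysis"
begin

section \<open>Finite simple graphs\<close>

text \<open>A graph is given by its vertex set and its set of edges, an edge being a two-element set.\<close>

definition simple_graph :: "'v set \<Rightarrow> 'v set set \<Rightarrow> bool" where
  "simple_graph V E \<longleftrightarrow>
     finite V \<and> (\<forall>e\<in>E. \<exists>u\<in>V. \<exists>v\<in>V. u \<noteq> v \<and> e = {u, v})"

definition connected_graph :: "'v set \<Rightarrow> 'v set set \<Rightarrow> bool" where
  "connected_graph V E \<longleftrightarrow>
     V \<noteq> {} \<and> (\<forall>u\<in>V. \<forall>v\<in>V. (u, v) \<in> {(x, y). {x, y} \<in> E}\<^sup>*)"

definition degree :: "'v set set \<Rightarrow> 'v \<Rightarrow> nat" where
  "degree E v = card {e \<in> E. v \<in> e}"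

definition eulerian :: "'v set \<Rightarrow> 'v set set \<Rightarrow> bool" where
  "eulerian V E \<longleftrightarrow> (\<forall>v\<in>V. even (degree E v))"

definition proper_coloring :: "'v set \<Rightarrow> 'v set set \<Rightarrow> nat \<Rightarrow> ('v \<Rightarrow> nat) \<Rightarrow> bool" where
  "proper_coloring V E k c \<longleftrightarrow>
     (\<forall>v\<in>V. c v < k) \<and> (\<forall>u\<in>V. \<forall>v\<in>V. {u, v} \<in> E \<longrightarrow> c u \<noteq> c v)"

definition chromatic_number :: "'v set \<Rightarrow> 'v set set \<Rightarrow> nat" where
  "chromatic_number V E = (LEAST k. \<exists>c. proper_coloring V E k c)"

definition deg_cong_count :: "nat \<Rightarrow> nat \<Rightarrow> 'v set \<Rightarrow> 'v set set \<Rightarrow> nat" where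
  "deg_cong_count n k V E = card {v \<in> V. degree E v mod n = k mod n}"


section \<open>Triangulations of closed surfaces\<close>

text \<open>
  Connectedness of the surface is not required here; it follows as soon as a connected graph
  triangulates the surface.
\<close>

definition closed_surface :: "'p topology \<Rightarrow> bool" where
  "closed_surface X \<longleftrightarrow>
     compact_space X \<and> Hausdorff_space X \<and> second_countable X \<and>
     (\<forall>x\<in>topspace X. \<exists>U. openin X U \<and> x \<in> U \<and>
        subtopology X U homeomorphic_space (euclidean :: (real^2) topology))"

text \<open>
  An embedding sends each vertex \<open>v\<close> to a point \<open>\<phi> v\<close> and each edge \<open>e\<close> to a simple arc
  \<open>\<gamma> e\<close> joining the images of its two ends; the arcs meet vertices and each other in common
  end points only. The parametrisation of the arc may run in either direction.
\<close>

definition graph_embedding ::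
  "'p topology \<Rightarrow> 'v set \<Rightarrow> 'v set set \<Rightarrow> ('v \<Rightarrow> 'p) \<Rightarrow> ('v set \<Rightarrow> real \<Rightarrow> 'p) \<Rightarrow> bool" where
  "graph_embedding X V E \<phi> \<gamma> \<longleftrightarrow>
     inj_on \<phi> V \<and> \<phi> ` V \<subseteq> topspace X \<and>
     (\<forall>e\<in>E. pathin X (\<gamma> e) \<and> inj_on (\<gamma> e) {0..1} \<and> {\<gamma> e 0, \<gamma> e 1} = \<phi> ` e \<and>
        \<gamma> e ` {0<..<1} \<inter> \<phi> ` V = {}) \<and>
     (\<forall>e\<in>E. \<forall>e'\<in>E. e \<noteq> e' \<longrightarrow> \<gamma> e ` {0<..<1} \<inter> \<gamma> e' ` {0<..<1} = {})"

definition faces ::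
  "'p topology \<Rightarrow> 'v set \<Rightarrow> 'v set set \<Rightarrow> ('v \<Rightarrow> 'p) \<Rightarrow> ('v set \<Rightarrow> real \<Rightarrow> 'p) \<Rightarrow> 'p set set" where
  "faces X V E \<phi> \<gamma> =
     connected_components_of
       (subtopology X (topspace X - (\<phi> ` V \<union> (\<Union>e\<in>E. \<gamma> e ` {0..1}))))"

text \<open>
  A face is a triangle if it is an open disc bounded by a 3-cycle of the graph: its closure is a
  closed disc whose boundary circle is formed by the three edges of the cycle.
\<close>

definition triangular_face ::
  "'p topology \<Rightarrow> 'v set set \<Rightarrow> ('v set \<Rightarrow> real \<Rightarrow> 'p) \<Rightarrow> 'p set \<Rightarrow> bool" where
  "triangular_face X E \<gamma> F \<longleftrightarrow>
     (\<exists>u v w. u \<noteq> v \<and> v \<noteq> w \<and> u \<noteq> w \<and> {u, v} \<in> E \<and> {v, w} \<in> E \<and> {u, w} \<in> E \<and>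
        (\<exists>h. homeomorphic_map (top_of_set (cball (0::real^2) 1))
               (subtopology X (X closure_of F)) h \<and>
             h ` ball 0 1 = F \<and>
             h ` sphere 0 1 =
               \<gamma> {u, v} ` {0..1} \<union> \<gamma> {v, w} ` {0..1} \<union> \<gamma> {u, w} ` {0..1}))"

definition triangulation_of :: "'p topology \<Rightarrow> 'v set \<Rightarrow> 'v set set \<Rightarrow> bool" where
  "triangulation_of X V E \<longleftrightarrow>
     (\<exists>\<phi> \<gamma>. graph_embedding X V E \<phi> \<gamma> \<and>
        (\<forall>F\<in>faces X V E \<phi> \<gamma>. triangular_face X E \<gamma> F) \<and>
        (\<forall>F\<in>faces X V E \<phi> \<gamma>. \<forall>F'\<in>faces X V E \<phi> \<gamma>. F \<noteq> F' \<longrightarrow>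
           card {e \<in> E. \<gamma> e ` {0..1} \<subseteq> X closure_of F \<inter> X closure_of F'} \<le> 1))"


section \<open>The feedback game\<close>

text \<open>
  A position is recorded as its history: the nonempty list of the successive locations of the
  token, whose head is the starting vertex. The edges traversed so far have been deleted.
\<close>

datatype player = Alice | Bob

definition remaining_edges :: "'v set set \<Rightarrow> 'v list \<Rightarrow> 'v set set" where
  "remaining_edges E p = E - {{p ! i, p ! Suc i} | i. Suc i < length p}"

definition legal_move :: "'v set set \<Rightarrow> 'v list \<Rightarrow> 'v \<Rightarrow> bool" where
  "legal_move E p v \<longleftrightarrow> {last p, v} \<in> remaining_edges E p"

definition game_over :: "'v set set \<Rightarrow> 'v list \<Rightarrow> bool" where
  "game_over E p \<longleftrightarrow>
     length p \<ge> 2 \<and> (last p = hd p \<or> (\<forall>e\<in>remaining_edges E p. last p \<notin> e))"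

definition to_move :: "'v list \<Rightarrow> player" where
  "to_move p = (if odd (length p) then Alice else Bob)"

definition last_mover :: "'v list \<Rightarrow> player" where
  "last_mover p = (if even (length p) then Alice else Bob)"

text \<open>The plays, finished or not, in which player \<open>P\<close> follows the strategy \<open>\<sigma>\<close>.\<close>

inductive_set plays_following ::
  "'v set set \<Rightarrow> 'v \<Rightarrow> player \<Rightarrow> ('v list \<Rightarrow> 'v) \<Rightarrow> 'v list set"
  for E :: "'v set set" and s :: 'v and P :: player and \<sigma> :: "'v list \<Rightarrow> 'v" where
  start: "[s] \<in> plays_following E s P \<sigma>"
| move: "\<lbrakk>p \<in> plays_following E s P \<sigma>; \<not> game_over E p; legal_move E p v;
          to_move p = P \<Longrightarrow> v = \<sigma> p\<rbrakk> \<Longrightarrow> p @ [v] \<in> plays_following E s P \<sigma>"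

text \<open>
  Every move deletes an edge, so on a finite graph all plays are finite. A strategy is winning if
  each play following it that cannot be continued has ended by a winning move of its owner; in
  particular a strategy that proposes an illegal move is not winning.
\<close>

definition winning_strategy ::
  "'v set set \<Rightarrow> 'v \<Rightarrow> player \<Rightarrow> ('v list \<Rightarrow> 'v) \<Rightarrow> bool" where
  "winning_strategy E s P \<sigma> \<longleftrightarrow>
     (\<forall>p\<in>plays_following E s P \<sigma>.
        (\<nexists>v. p @ [v] \<in> plays_following E s P \<sigma>) \<longrightarrow> game_over E p \<and> last_mover p = P)"

definition wins_feedback_game :: "'v set set \<Rightarrow> 'v \<Rightarrow> player \<Rightarrow> bool" where
  "wins_feedback_game E s P \<longleftrightarrow> (\<exists>\<sigma>. winning_strategy E s P \<sigma>)"

end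

theory Submission
  imports Defs
begin

text \<open>
  Every edge of the triangulation lies on exactly two faces. Gluing the collars of an edge in two
  of its faces gives an injective map from an open rectangle, whose image is open by invariance of
  domain and leaves no room for a third face; with at most one face, a neighbourhood of a point of
  the edge would embed in the plane on one side of a line through the image of that point.

  At a vertex \<open>v\<close>, each incident face contains exactly one edge from \<open>v\<close> to each of the other two
  colour classes, so double counting shows that \<open>v\<close> has \<open>degree E v / 2\<close> neighbours in each of them,
  an even number. Hence Bob can always move back to the colour class of the starting vertex; Alice
  always leaves that class and so never closes the tour.
\<close>

section \<open>Bob's strategy: parity of played edges outside one colour class\<close>

section \<open>The feedback game on a coloured graph\<close>

text \<open>The set subtracted in \<open>remaining_edges\<close>, isolated so that appending a move
  changes it by one insertion.\<close>

definition used_edges :: "'v list \<Rightarrow> 'v set set" where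
  "used_edges p = {{p ! i, p ! Suc i} | i. Suc i < length p}"

lemma used_edges_single [simp]: "used_edges [s] = {}"
  by (simp add: used_edges_def)

lemma used_edges_snoc:
  assumes "p \<noteq> []"
  shows "used_edges (p @ [x]) = insert {last p, x} (used_edges p)"
proof -
  have "used_edges (p @ [x]) = (\<lambda>i. {(p @ [x]) ! i, (p @ [x]) ! Suc i}) ` {i. Suc i < Suc (length p)}"
    by (auto simp: used_edges_def)
  also have "{i. Suc i < Suc (length p)} = insert (length p - 1) {i. Suc i < length p}"
    using assms by (auto simp: neq_Nil_conv)
  also have "(\<lambda>i. {(p @ [x]) ! i, (p @ [x]) ! Suc i}) ` insert (length p - 1) {i. Suc i < length p}
      = insert {last p, x} ((\<lambda>i. {p ! i, p ! Suc i}) ` {i. Suc i < length p})"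
    using assms by (auto simp: nth_append last_conv_nth intro!: image_eqI)
  finally show ?thesis
    by (auto simp: used_edges_def)
qed

lemma legal_move_iff:
  "legal_move E p v \<longleftrightarrow> {last p, v} \<in> E \<and> {last p, v} \<notin> used_edges p"
  by (simp add: legal_move_def remaining_edges_def used_edges_def)

lemma simple_graph_finite_edges:
  assumes "simple_graph V E"
  shows "finite E"
proof (rule finite_subset)
  show "E \<subseteq> Pow V" using assms unfolding simple_graph_def by fastforce
  show "finite (Pow V)" using assms by (simp add: simple_graph_def)
qed

lemma simple_graph_edgeD:
  assumes "simple_graph V E" "{u, v} \<in> E"
  shows "u \<noteq> v" "u \<in> V" "v \<in> V"
  using assms unfolding simple_graph_def by (metis doubleton_eq_iff insert_absorb2)+

lemma simple_graph_edge_at: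
  assumes "simple_graph V E" "e \<in> E" "v \<in> e"
  obtains u where "e = {v, u}" "u \<noteq> v"
  using assms unfolding simple_graph_def by (metis insert_commute insert_iff singletonD)

text \<open>By \<open>proper\<close>, the class of \<open>s\<close> is independent, so every move of
  Alice from it leaves it. While Bob answers inside the class, each played edge meets it. At a
  vertex outside the class where Bob has to move, an odd number of such edges is used up out of an
  even total, so one is left for the way back. The edge to \<open>t\<close> gives Alice a first
  move.\<close>

lemma Bob_wins_by_colour_class:
  assumes G: "simple_graph V E"
    and s: "{s, t} \<in> E"
    and proper: "\<And>u v. {u, v} \<in> E \<Longrightarrow> c u = c s \<Longrightarrow> c v \<noteq> c s"
    and even: "\<And>v. v \<in> V \<Longrightarrow> c v \<noteq> c s \<Longrightarrow> even (card {e \<in> E. v \<in> e \<and> (\<exists>u\<in>e. c u = c s)})"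
  shows "wins_feedback_game E s Bob"
proof -
  have finE: "finite E" using simple_graph_finite_edges[OF G] .
  define \<sigma> where "\<sigma> p = (SOME w. legal_move E p w \<and> c w = c s)" for p
  \<comment> \<open>The last clause is the degree parity of a trail: away from its start
    \<open>s\<close>, which lies in the class, only the current end has odd degree.\<close>
  define inv where "inv p \<longleftrightarrow> p \<noteq> [] \<and> hd p = s \<and> last p \<in> V \<and> (c (last p) = c s \<longleftrightarrow> odd (length p))
     \<and> used_edges p \<subseteq> {e \<in> E. \<exists>u\<in>e. c u = c s}
     \<and> (\<forall>v. c v \<noteq> c s \<longrightarrow> (odd (card {e \<in> used_edges p. v \<in> e}) \<longleftrightarrow> v = last p))" for p
  have reply: "legal_move E p (\<sigma> p) \<and> c (\<sigma> p) = c s" if p: "inv p" "even (length p)" for p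
  proof -
    define v where "v = last p"
    let ?A = "{e \<in> E. v \<in> e \<and> (\<exists>u\<in>e. c u = c s)}" and ?B = "{e \<in> used_edges p. v \<in> e}"
    have v: "v \<in> V" "c v \<noteq> c s" using p by (auto simp: inv_def v_def)
    have "?B \<subseteq> ?A" using p by (auto simp: inv_def)
    moreover have "odd (card ?B)" using p v by (simp add: inv_def v_def)
    moreover have "even (card ?A)" using even v by blast
    \<comment> \<open>An odd subset of an even set is proper.\<close>
    ultimately have "\<not> ?A \<subseteq> ?B" using subset_antisym[of ?A ?B] by force
    then obtain e where e: "e \<in> ?A" "e \<notin> ?B" by blast
    then obtain u where u: "e = {v, u}" using simple_graph_edge_at[OF G, of e v] by blast
    have "legal_move E p u \<and> c u = c s"
      using e u v by (auto simp: legal_move_iff v_def)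
    then show ?thesis unfolding \<sigma>_def by (rule someI)
  qed
  have inv: "inv p" if "p \<in> plays_following E s Bob \<sigma>" for p
    using that
  proof induction
    case start
    then show ?case using simple_graph_edgeD[OF G s] by (auto simp: inv_def)
  next
    case (move p x)
    have e: "{last p, x} \<in> E" "{last p, x} \<notin> used_edges p"
      using move.hyps by (simp_all add: legal_move_iff)
    have colour: "c x = c s \<longleftrightarrow> even (length p)"
    proof (cases "even (length p)")
      case True
      then show ?thesis using move.hyps reply[OF \<open>inv p\<close>] by (auto simp: to_move_def)
    next
      case False
      then show ?thesis using proper[OF e(1)] \<open>inv p\<close> by (auto simp: inv_def)
    qed
    have ne: "p \<noteq> []" using \<open>inv p\<close> by (simp add: inv_def)
    have fin: "finite (used_edges p)" using \<open>inv p\<close> finE by (auto simp: inv_def intro: finite_subset)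
    have lx: "last p \<noteq> x" using simple_graph_edgeD[OF G e(1)] by blast
    \<comment> \<open>The new edge flips the parity at its two ends: the old end becomes even and
      the new end \<open>x\<close> becomes odd, as it was even because \<open>x\<close> differs from
      \<open>last p\<close>.\<close>
    have card: "odd (card {e \<in> used_edges (p @ [x]). v \<in> e}) \<longleftrightarrow> v = x" if v: "c v \<noteq> c s" for v
    proof (cases "v \<in> {last p, x}")
      case True
      have "{e \<in> used_edges (p @ [x]). v \<in> e} = insert {last p, x} {e \<in> used_edges p. v \<in> e}"
        using True ne by (auto simp: used_edges_snoc)
      then have "card {e \<in> used_edges (p @ [x]). v \<in> e} = Suc (card {e \<in> used_edges p. v \<in> e})"
        using fin e by simp
      then show ?thesis using \<open>inv p\<close> v True lx by (auto simp: inv_def)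
    next
      case False
      then have "{e \<in> used_edges (p @ [x]). v \<in> e} = {e \<in> used_edges p. v \<in> e}"
        using ne by (auto simp: used_edges_snoc)
      then show ?thesis using \<open>inv p\<close> v False by (auto simp: inv_def)
    qed
    have "\<exists>u\<in>{last p, x}. c u = c s"
      using colour \<open>inv p\<close> by (auto simp: inv_def)
    then show ?case using \<open>inv p\<close> colour card e(1) simple_graph_edgeD[OF G e(1)]
      by (simp add: inv_def used_edges_snoc)
  qed
  have "game_over E p \<and> last_mover p = Bob"
    if p: "p \<in> plays_following E s Bob \<sigma>" and stuck: "\<nexists>v. p @ [v] \<in> plays_following E s Bob \<sigma>" for p
  proof -
    note ip = inv[OF p]
    show ?thesis
    proof (cases "even (length p)")
      case True
      \<comment> \<open>With Bob to move the game is not over: the token is outside the class of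
        \<open>s\<close>, hence not at \<open>s\<close>, and the reply uses a remaining edge. So the
        play could be continued, against \<open>stuck\<close>.\<close>
      have legal: "legal_move E p (\<sigma> p)" using reply[OF ip True] by blast
      then have "{last p, \<sigma> p} \<in> remaining_edges E p" by (simp add: legal_move_def)
      moreover have "last p \<noteq> hd p" using ip True by (auto simp: inv_def)
      ultimately have "\<not> game_over E p" by (auto simp: game_over_def)
      then show ?thesis using plays_following.move[OF p _ legal] stuck by blast
    next
      case False
      then have turn: "to_move p = Alice" "last_mover p = Bob" by (auto simp: to_move_def last_mover_def)
      have no: "\<not> legal_move E p v" if "\<not> game_over E p" for v
        using plays_following.move[OF p that, of v] stuck turn by auto
      have "game_over E p"
      proof (rule ccontr)
        assume ng: "\<not> game_over E p"
        show False
        proof (cases "length p \<ge> 2")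
          case True
          then obtain e where e: "e \<in> remaining_edges E p" "last p \<in> e"
            using ng by (auto simp: game_over_def)
          then obtain u where "e = {last p, u}"
            using simple_graph_edge_at[OF G, of e "last p"] by (auto simp: remaining_edges_def)
          then show False using no[OF ng, of u] e by (simp add: legal_move_def)
        next
          case False
          \<comment> \<open>The initial position never counts as \<open>game_over\<close>, so it
            must be shown not to be stuck; the edge to \<open>t\<close> does this.\<close>
          then have "p = [s]" using ip by (cases p) (auto simp: inv_def Suc_le_eq)
          then show False using no[OF ng, of t] s by (simp add: legal_move_iff)
        qed
      qed
      then show ?thesis using turn by blast
    qed
  qed
  then show ?thesis
    unfolding wins_feedback_game_def winning_strategy_def by blast
qed


section \<open>Triangles at a vertex counted by colour, and colourings attaining the chromatic
  number\<close>

section \<open>Colourings\<close>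

text \<open>Pairs of an edge from \<open>v\<close> to colour \<open>b\<close> and a triangle
  containing it are counted twice over: each such edge lies in two triangles, and each triangle at
  \<open>v\<close> has exactly one such edge. The resulting number of triangles at \<open>v\<close>
  does not depend on \<open>b\<close>, so the two colours other than \<open>c v\<close> share the
  edges at \<open>v\<close> equally.\<close>

lemma triangles_colour_degree:
  assumes G: "simple_graph V E"
    and fin: "finite \<T>"
    and tri: "\<And>T. T \<in> \<T> \<Longrightarrow> \<exists>u v w. u \<noteq> v \<and> v \<noteq> w \<and> u \<noteq> w \<and> T = {u, v, w} \<and>
                {u, v} \<in> E \<and> {v, w} \<in> E \<and> {u, w} \<in> E"
    and two: "\<And>e. e \<in> E \<Longrightarrow> card {T \<in> \<T>. e \<subseteq> T} = 2"
    and c: "proper_coloring V E 3 c"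
    and v: "v \<in> V" and b: "b < 3" "c v \<noteq> b"
  shows "2 * card {e \<in> E. v \<in> e \<and> (\<exists>u\<in>e. c u = b)} = degree E v"
proof -
  define N where "N b = {e \<in> E. v \<in> e \<and> (\<exists>u\<in>e. c u = b)}" for b
  have finE: "finite E" using simple_graph_finite_edges[OF G] .
  have finN: "finite (N b)" for b using finE by (simp add: N_def)
  have col: "c x < 3" "c y < 3" "c x \<noteq> c y" if "{x, y} \<in> E" for x y
    using c simple_graph_edgeD[OF G that] that by (auto simp: proper_coloring_def)
  have count: "2 * card (N b) = card {T \<in> \<T>. v \<in> T}" if b: "b < 3" "c v \<noteq> b" for b
  proof -
    have one: "card {e \<in> N b. e \<subseteq> T} = 1" if T: "T \<in> {T \<in> \<T>. v \<in> T}" for T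
    proof -
      have "\<exists>x y. T = {v, x, y} \<and> {v, x} \<in> E \<and> {x, y} \<in> E \<and> {v, y} \<in> E"
      proof -
        obtain x y z where "T = {x, y, z}" and xyz: "{x, y} \<in> E" "{y, z} \<in> E" "{x, z} \<in> E"
          using tri[of T] T by auto
        then consider "T = {v, y, z}" "v = x" | "T = {v, x, z}" "v = y" | "T = {v, x, y}" "v = z"
          using T by blast
        then show ?thesis by cases (use xyz in \<open>metis insert_commute\<close>)+
      qed
      then obtain x y where xy: "T = {v, x, y}" "{v, x} \<in> E" "{x, y} \<in> E" "{v, y} \<in> E" by blast
      \<comment> \<open>The triangle carries all three colours and \<open>c v\<close> is not
        \<open>b\<close>, so one of the other two corners has colour \<open>b\<close> and may be
        named \<open>x\<close>.\<close>
      have "\<exists>x y. T = {v, x, y} \<and> {v, x} \<in> E \<and> {x, y} \<in> E \<and> {v, y} \<in> E \<and> c x = b"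
      proof (cases "c x = b")
        case False
        then have "c y = b" using col[OF xy(2)] col[OF xy(3)] col[OF xy(4)] b by linarith
        then show ?thesis using xy by (intro exI[of _ y] exI[of _ x]) (simp add: insert_commute)
      qed (use xy in blast)
      then obtain x y where xy: "T = {v, x, y}" "{v, x} \<in> E" "{x, y} \<in> E" "{v, y} \<in> E" "c x = b"
        by blast
      have "{e \<in> N b. e \<subseteq> T} = {{v, x}}"
      proof (intro equalityI subsetI)
        fix e assume e: "e \<in> {e \<in> N b. e \<subseteq> T}"
        then obtain u where u: "e = {v, u}"
          using simple_graph_edge_at[OF G, of e v] by (auto simp: N_def)
        then show "e \<in> {{v, x}}"
          using e b xy col[OF xy(3)] simple_graph_edgeD[OF G, of v u] by (auto simp: N_def)
      qed (use xy in \<open>auto simp: N_def\<close>)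
      then show ?thesis by simp
    qed
    have two': "card {T \<in> {T \<in> \<T>. v \<in> T}. e \<subseteq> T} = 2" if "e \<in> N b" for e
    proof -
      have "{T \<in> {T \<in> \<T>. v \<in> T}. e \<subseteq> T} = {T \<in> \<T>. e \<subseteq> T}" using that by (auto simp: N_def)
      then show ?thesis using two that by (simp add: N_def)
    qed
    have "(\<Sum>e\<in>N b. card {T \<in> {T \<in> \<T>. v \<in> T}. e \<subseteq> T}) = 1 * card {T \<in> \<T>. v \<in> T}"
      by (rule sum_multicount[where k = 1]) (use fin finN one in auto)
    then show ?thesis using two' by simp
  qed
  obtain b' where b': "b' < 3" "b' \<noteq> b" "b' \<noteq> c v"
  proof -
    have "c v < 3" using c v by (simp add: proper_coloring_def)
    \<comment> \<open>The colours 0, 1, 2 add up to 3, so this is the third colour; the subtraction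
      is not truncated because two distinct colours add up to at most 3.\<close>
    then have "3 - b - c v < 3 \<and> 3 - b - c v \<noteq> b \<and> 3 - b - c v \<noteq> c v" using b by presburger
    then show ?thesis using that by blast
  qed
  have cases: "x = c v \<or> x = b \<or> x = b'" if "x < 3" for x
    using that b' b c v by (auto simp: proper_coloring_def less_Suc_eq numeral_3_eq_3)
  have edge: "\<exists>u. e = {v, u} \<and> c u < 3 \<and> c u \<noteq> c v" if "e \<in> E" "v \<in> e" for e
    using simple_graph_edge_at[OF G that] col that by metis
  have "e \<in> N b \<union> N b' \<and> \<not> (e \<in> N b \<and> e \<in> N b')" if e: "e \<in> E" "v \<in> e" for e
  proof -
    obtain u where u: "e = {v, u}" "c u < 3" "c u \<noteq> c v" using edge[OF e] by blast
    then show ?thesis using cases[of "c u"] b b' e by (auto simp: N_def)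
  qed
  then have "{e \<in> E. v \<in> e} = N b \<union> N b'" "N b \<inter> N b' = {}"
    by (auto simp: N_def)
  then have "degree E v = card (N b) + card (N b')"
    by (simp add: degree_def card_Un_disjoint finN)
  then show ?thesis using count[OF b] count[of b'] b' by (simp add: N_def)
qed

text \<open>Giving all vertices different colours works; this makes the \<open>LEAST\<close> in
  \<open>chromatic_number\<close> range over a nonempty set.\<close>

lemma simple_graph_colourable:
  assumes "simple_graph V E"
  shows "\<exists>c. proper_coloring V E (card V) c"
proof -
  obtain f where f: "inj_on f V" "f ` V = {..<card V}"
    using assms by (metis simple_graph_def bij_betw_def ex_bij_betw_finite_nat atLeast0LessThan)
  then have "proper_coloring V E (card V) f"
    using simple_graph_edgeD[OF assms] by (auto simp: proper_coloring_def dest: inj_onD)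
  then show ?thesis by blast
qed

lemma chromatic_number_colouring:
  assumes "simple_graph V E"
  shows "\<exists>c. proper_coloring V E (chromatic_number V E) c"
  unfolding chromatic_number_def
  by (rule LeastI_ex) (use simple_graph_colourable[OF assms] in blast)

text \<open>A graph whose only vertex is \<open>s\<close> is coloured by one colour, so there is a
  second vertex, and a path to it begins with an edge at \<open>s\<close>.\<close>

lemma connected_has_edge_at:
  assumes "simple_graph V E" "connected_graph V E" "chromatic_number V E \<ge> 2" "s \<in> V"
  obtains t where "{s, t} \<in> E"
proof -
  have "\<not> V \<subseteq> {s}"
  proof
    assume V: "V \<subseteq> {s}"
    have "proper_coloring V E 1 (\<lambda>_. 0)"
      using V simple_graph_edgeD[OF assms(1)] unfolding proper_coloring_def by (metis less_one singletonD subsetD)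
    then have "chromatic_number V E \<le> 1"
      unfolding chromatic_number_def by (intro Least_le) blast
    then show False using assms(3) by simp
  qed
  then obtain u where "u \<in> V" "u \<noteq> s" by blast
  then have "(s, u) \<in> {(x, y). {x, y} \<in> E}\<^sup>*"
    using assms by (simp add: connected_graph_def)
  then show ?thesis using \<open>u \<noteq> s\<close> that by (cases rule: converse_rtranclE) auto
qed


section \<open>Brouwer's theorem carried over to surfaces through charts\<close>

section \<open>Invariance of domain on surfaces\<close>

lemma closed_surface_chart:
  assumes "closed_surface X" "x \<in> topspace X"
  obtains U k l where "openin X U" "x \<in> U"
    "homeomorphic_maps (subtopology X U) (euclidean :: (real^2) topology) k l"
proof -
  obtain U where "openin X U" "x \<in> U" "subtopology X U homeomorphic_space (euclidean :: (real^2) topology)"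
    using assms unfolding closed_surface_def by blast
  then show ?thesis using that unfolding homeomorphic_space_def by (elim exE) (rule that)
qed

text \<open>Openness is local: near a point, \<open>f\<close> composed with an inverse chart
  \<open>l\<close> is a continuous injection between open parts of the plane, to which Brouwer's
  theorem applies.\<close>

lemma invariance_of_domain_from_surface:
  fixes f :: "'p \<Rightarrow> real^2"
  assumes X: "closed_surface X" and N: "openin X N"
    and f: "continuous_map (subtopology X N) euclidean f" "inj_on f N"
  shows "open (f ` N)"
proof (subst open_subopen, intro ballI)
  fix y assume "y \<in> f ` N"
  then obtain x where x: "x \<in> N" "y = f x" by blast
  then have xX: "x \<in> topspace X" using openin_subset[OF N] by blast
  obtain U k l where U: "openin X U" "x \<in> U"
    and kl: "homeomorphic_maps (subtopology X U) (euclidean :: (real^2) topology) k l"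
    using closed_surface_chart[OF X xX] .
  have UX: "topspace (subtopology X U) = U" using openin_subset[OF U(1)] by (simp add: inf_absorb2)
  have l: "continuous_map euclidean (subtopology X U) l" and k: "\<And>x. x \<in> U \<Longrightarrow> l (k x) = x" "\<And>z. k (l z) = z"
    using kl UX by (auto simp: homeomorphic_maps_def)
  have lX: "continuous_map euclidean X l" using l by (simp add: continuous_map_in_subtopology)
  define S where "S = {z. l z \<in> N}"
  have S: "open S" using openin_continuous_map_preimage[OF lX N] by (simp add: S_def)
  have "continuous_map (top_of_set S) (subtopology X N) l"
    using lX by (auto simp: continuous_map_in_subtopology S_def intro: continuous_map_from_subtopology)
  then have "continuous_on S (f \<circ> l)"
    using continuous_map_compose[OF _ f(1)] by fastforce
  moreover have "inj_on (f \<circ> l) S"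
    using f(2) k(2) by (auto simp: inj_on_def S_def) metis
  ultimately have "open ((f \<circ> l) ` S)" using S invariance_of_domain by blast
  moreover have "y \<in> (f \<circ> l) ` S"
    using x U k(1)[of x] by (auto simp: S_def intro!: image_eqI[of _ _ "k x"])
  ultimately show "\<exists>T. open T \<and> y \<in> T \<and> T \<subseteq> f ` N"
    by (intro exI[of _ "(f \<circ> l) ` S"]) (auto simp: S_def)
qed

text \<open>Near each point \<open>g\<close> is followed by a chart \<open>k\<close>; the image is
  open in the plane and is carried back by the inverse chart. The domain is any two-dimensional
  space because collars of edges are parametrised by \<open>real \<times> real\<close>.\<close>

lemma invariance_of_domain_into_surface:
  fixes g :: "'a::euclidean_space \<Rightarrow> 'p"
  assumes X: "closed_surface X" and W: "open W" and dim: "DIM('a) = 2"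
    and g: "continuous_map (top_of_set W) X g" "inj_on g W"
  shows "openin X (g ` W)"
proof (subst openin_subopen, intro ballI)
  fix y assume "y \<in> g ` W"
  then obtain w where w: "w \<in> W" "y = g w" by blast
  have gX: "g w \<in> topspace X" using continuous_map_image_subset_topspace[OF g(1)] w by auto
  obtain U k l where U: "openin X U" "g w \<in> U"
    and kl: "homeomorphic_maps (subtopology X U) (euclidean :: (real^2) topology) k l"
    using closed_surface_chart[OF X gX] .
  have UX: "topspace (subtopology X U) = U" using openin_subset[OF U(1)] by (simp add: inf_absorb2)
  have k: "continuous_map (subtopology X U) euclidean k" "\<And>x. x \<in> U \<Longrightarrow> l (k x) = x"
    using kl UX by (auto simp: homeomorphic_maps_def)
  have l: "homeomorphic_map euclidean (subtopology X U) l"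
    using kl homeomorphic_maps_map by blast
  define W' where "W' = {z \<in> W. g z \<in> U}"
  have "openin (top_of_set W) W'"
    using openin_continuous_map_preimage[OF g(1) U(1)] by (simp add: W'_def)
  then have W': "open W'" using W openin_open_eq by blast
  have "continuous_map (top_of_set W') (subtopology X U) g"
    using continuous_map_from_subtopology_mono[OF g(1), of W'] by (auto simp: continuous_map_in_subtopology W'_def)
  then have "continuous_on W' (k \<circ> g)"
    using continuous_map_compose[OF _ k(1)] by fastforce
  moreover have "inj_on (k \<circ> g) W'"
    using g(2) k(2) unfolding inj_on_def W'_def by (metis (mono_tags, lifting) comp_apply mem_Collect_eq)
  ultimately have "open ((k \<circ> g) ` W')"
    using W' dim by (intro invariance_of_domain_gen) auto
  then have "openin (subtopology X U) (l ` (k \<circ> g) ` W')"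
    using homeomorphic_map_openness[OF l] by simp
  moreover have "l ` (k \<circ> g) ` W' = g ` W'"
    using k(2) by (force simp: W'_def image_image)
  ultimately have "openin X (g ` W')" using openin_trans_full U(1) by metis
  moreover have "y \<in> g ` W'" "g ` W' \<subseteq> g ` W" using w U by (auto simp: W'_def)
  ultimately show "\<exists>T. openin X T \<and> y \<in> T \<and> T \<subseteq> g ` W" by blast
qed

lemma open_no_linear_maximum:
  fixes a p :: "'a::real_inner"
  assumes "open S" "p \<in> S" "a \<noteq> 0"
  shows "\<exists>q\<in>S. a \<bullet> p < a \<bullet> q"
proof -
  obtain e where e: "e > 0" "ball p e \<subseteq> S" using assms open_contains_ball by blast
  define q where "q = p + (e / (2 * norm a)) *\<^sub>R a"
  have "dist p q < e" using e assms(3) by (simp add: q_def dist_norm)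
  moreover have "a \<bullet> p < a \<bullet> q" using e assms(3) by (simp add: q_def inner_add_right)
  ultimately show ?thesis using e by auto
qed

text \<open>The image of \<open>N\<close> is open, so no linear functional has a maximum on it. This
  excludes a boundary point of the surface, and so an edge with fewer than two faces.\<close>

lemma surface_not_half_plane:
  fixes f :: "'p \<Rightarrow> real^2"
  assumes "closed_surface X" "openin X N"
    and "continuous_map (subtopology X N) euclidean f" "inj_on f N"
    and "p \<in> N" "a \<noteq> 0" "\<And>x. x \<in> N \<Longrightarrow> a \<bullet> f x \<le> a \<bullet> f p"
  shows False
proof -
  have "open (f ` N)" using invariance_of_domain_from_surface assms by blast
  then obtain q where "q \<in> f ` N" "a \<bullet> f p < a \<bullet> q" using open_no_linear_maximum assms by blast
  then show False using assms(7) by fastforce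
qed


section \<open>Incidence of arcs and faces in an embedded triangulation\<close>

section \<open>Faces along an edge\<close>

text \<open>Fixes one embedding, of which \<open>triangulation_of\<close> asserts only the
  existence, so that all facts speak of the same arcs and faces.\<close>

locale surface_triangulation =
  fixes X :: "'p topology" and V :: "'v set" and E :: "'v set set"
    and \<phi> :: "'v \<Rightarrow> 'p" and \<gamma> :: "'v set \<Rightarrow> real \<Rightarrow> 'p"
  assumes surface: "closed_surface X"
    and graph: "simple_graph V E"
    and embedding: "graph_embedding X V E \<phi> \<gamma>"
    and triangular: "\<And>F. F \<in> faces X V E \<phi> \<gamma> \<Longrightarrow> triangular_face X E \<gamma> F"
    and share: "\<And>F F'. F \<in> faces X V E \<phi> \<gamma> \<Longrightarrow> F' \<in> faces X V E \<phi> \<gamma> \<Longrightarrow> F \<noteq> F' \<Longrightarrow>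
           card {e \<in> E. \<gamma> e ` {0..1} \<subseteq> X closure_of F \<inter> X closure_of F'} \<le> 1"
begin

abbreviation "\<F> \<equiv> faces X V E \<phi> \<gamma>"

text \<open>Phrased by closures so that \<open>bd F \<inter> bd F'\<close> is the set of common
  edges bounded in \<open>share\<close>.\<close>

definition bd :: "'p set \<Rightarrow> 'v set set" where
  "bd F = {e \<in> E. \<gamma> e ` {0..1} \<subseteq> X closure_of F}"

definition inner_arc :: "'v set \<Rightarrow> 'p set" where
  "inner_arc e = \<gamma> e ` {0<..<1}"

lemma finite_E: "finite E"
  using simple_graph_finite_edges[OF graph] .

lemma Hausdorff: "Hausdorff_space X"
  using surface by (simp add: closed_surface_def)

lemma arc:
  assumes "e \<in> E"
  shows "continuous_map (top_of_set {0..1}) X (\<gamma> e)" "inj_on (\<gamma> e) {0..1}"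
    "{\<gamma> e 0, \<gamma> e 1} = \<phi> ` e" "inner_arc e \<inter> \<phi> ` V = {}"
  using embedding assms unfolding graph_embedding_def pathin_def inner_arc_def by blast+

lemma arc_eq:
  assumes "e \<in> E"
  shows "\<gamma> e ` {0..1} = inner_arc e \<union> \<phi> ` e"
proof -
  have "{0..1::real} = {0<..<1} \<union> {0, 1}" by auto
  then show ?thesis by (simp add: inner_arc_def flip: arc(3)[OF assms])
qed

lemma edge_sub_V: "e \<in> E \<Longrightarrow> e \<subseteq> V"
  using graph by (auto simp: simple_graph_def)

text \<open>Inner arcs avoid all vertices, so the common point is interior to both arcs, and
  distinct arcs have disjoint interiors.\<close>

lemma inner_arc_meets_arc:
  assumes "e \<in> E" "e' \<in> E" "x \<in> inner_arc e" "x \<in> \<gamma> e' ` {0..1}"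
  shows "e = e'"
proof -
  have "x \<notin> \<phi> ` e'" using assms arc(4)[of e] edge_sub_V[of e'] by blast
  then have "x \<in> inner_arc e'" using assms arc_eq[of e'] by blast
  moreover have "e \<noteq> e' \<Longrightarrow> inner_arc e \<inter> inner_arc e' = {}"
    using embedding assms unfolding graph_embedding_def inner_arc_def by blast
  ultimately show ?thesis using assms(3) by blast
qed

lemma arc_in_space: "e \<in> E \<Longrightarrow> \<gamma> e ` {0..1} \<subseteq> topspace X"
  using continuous_map_image_subset_topspace[OF arc(1)] by force

lemma closedin_arc: "e \<in> E \<Longrightarrow> closedin X (\<gamma> e ` {0..1})"
  by (intro compactin_imp_closedin[OF Hausdorff] image_compactin[OF _ arc(1)])
     (auto simp: compactin_subtopology)

lemma face_sub:
  assumes "F \<in> \<F>"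
  shows "F \<subseteq> topspace X" "F \<inter> \<phi> ` V = {}" "e \<in> E \<Longrightarrow> F \<inter> \<gamma> e ` {0..1} = {}"
proof -
  have "F \<subseteq> topspace X - (\<phi> ` V \<union> (\<Union>e\<in>E. \<gamma> e ` {0..1}))"
    using connected_components_of_subset[OF assms[unfolded faces_def]] by simp
  then show "F \<subseteq> topspace X" "F \<inter> \<phi> ` V = {}" "e \<in> E \<Longrightarrow> F \<inter> \<gamma> e ` {0..1} = {}"
    by blast+
qed

lemma face_inner_arc: "F \<in> \<F> \<Longrightarrow> e \<in> E \<Longrightarrow> F \<inter> inner_arc e = {}"
  using face_sub(3)[of F e] arc_eq[of e] by blast

lemma face_disjoint: "F \<in> \<F> \<Longrightarrow> F' \<in> \<F> \<Longrightarrow> F \<noteq> F' \<Longrightarrow> F \<inter> F' = {}"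
  unfolding faces_def by (simp add: connected_components_of_disjoint flip: disjnt_def)

lemma covered:
  assumes "x \<in> topspace X"
  shows "x \<in> \<phi> ` V \<or> (\<exists>e\<in>E. x \<in> \<gamma> e ` {0..1}) \<or> (\<exists>F\<in>\<F>. x \<in> F)"
proof (rule ccontr)
  assume n: "\<not> ?thesis"
  let ?Y = "subtopology X (topspace X - (\<phi> ` V \<union> (\<Union>e\<in>E. \<gamma> e ` {0..1})))"
  have "x \<in> topspace ?Y" using n assms by auto
  then have "x \<in> \<Union>\<F>" by (simp only: faces_def Union_connected_components_of)
  then show False using n by blast
qed

text \<open>The three claims rest on the same disc \<open>h\<close>. The closure of \<open>F\<close>
  is \<open>F\<close> together with the image of the circle. A point of an inner arc is not in
  \<open>F\<close>, so if it lies in the closure it is on one of the three arcs of the triangle, and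
  that arc is its own.\<close>

lemma
  assumes F: "F \<in> \<F>"
  shows face_triangle: "\<exists>u v w. u \<noteq> v \<and> v \<noteq> w \<and> u \<noteq> w \<and> bd F = {{u, v}, {v, w}, {u, w}} \<and>
      {u, v} \<in> E \<and> {v, w} \<in> E \<and> {u, w} \<in> E"
    and face_disc: "\<exists>h. homeomorphic_map (top_of_set (cball (0::real^2) 1)) (subtopology X (X closure_of F)) h \<and>
      h ` ball 0 1 = F \<and> h ` sphere 0 1 = (\<Union>e\<in>bd F. \<gamma> e ` {0..1})"
    and inner_arc_in_bd: "e \<in> E \<Longrightarrow> x \<in> inner_arc e \<Longrightarrow> x \<in> X closure_of F \<Longrightarrow> e \<in> bd F"
proof -
  obtain u v w h where uvw: "u \<noteq> v" "v \<noteq> w" "u \<noteq> w" "{u, v} \<in> E" "{v, w} \<in> E" "{u, w} \<in> E"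
    and h: "homeomorphic_map (top_of_set (cball (0::real^2) 1)) (subtopology X (X closure_of F)) h"
    "h ` ball 0 1 = F"
    "h ` sphere 0 1 = \<gamma> {u, v} ` {0..1} \<union> \<gamma> {v, w} ` {0..1} \<union> \<gamma> {u, w} ` {0..1}"
    using triangular[OF F] unfolding triangular_face_def by blast
  have "topspace (subtopology X (X closure_of F)) = X closure_of F"
    using closure_of_subset_topspace[of X F] by auto
  then have cl: "h ` cball 0 1 = X closure_of F"
    using homeomorphic_imp_surjective_map[OF h(1)] by simp
  moreover have "cball 0 1 = ball 0 1 \<union> sphere (0::real^2) 1" by auto
  then have "h ` cball 0 1 = h ` ball 0 1 \<union> h ` sphere 0 1" by (simp only: image_Un)
  ultimately have cl': "X closure_of F = F \<union> h ` sphere 0 1"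
    using h(2) by simp
  have inc: "e \<in> {{u, v}, {v, w}, {u, w}}" if e: "e \<in> E" "x \<in> inner_arc e" "x \<in> X closure_of F" for e x
  proof -
    have "x \<notin> F" using face_inner_arc[OF F e(1)] e(2) by blast
    then have "x \<in> h ` sphere 0 1" using cl' e(3) by blast
    then obtain e' where "e' \<in> {{u, v}, {v, w}, {u, w}}" "x \<in> \<gamma> e' ` {0..1}"
      unfolding h(3) by blast
    moreover from this have "e' \<in> E" using uvw by blast
    ultimately show ?thesis using inner_arc_meets_arc[OF e(1) _ e(2)] by metis
  qed
  have "bd F = {{u, v}, {v, w}, {u, w}}"
  proof
    show "bd F \<subseteq> {{u, v}, {v, w}, {u, w}}"
    proof
      fix e assume e: "e \<in> bd F"
      \<comment> \<open>The midpoint serves as a test point interior to the arc.\<close>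
      have "\<gamma> e (1/2) \<in> inner_arc e" "\<gamma> e (1/2) \<in> \<gamma> e ` {0..1}" by (auto simp: inner_arc_def)
      moreover have "e \<in> E" "\<gamma> e ` {0..1} \<subseteq> X closure_of F" using e by (auto simp: bd_def)
      ultimately show "e \<in> {{u, v}, {v, w}, {u, w}}" using inc[of e "\<gamma> e (1/2)"] by blast
    qed
    show "{{u, v}, {v, w}, {u, w}} \<subseteq> bd F" using cl' h(3) uvw by (auto simp: bd_def)
  qed
  note bd = this
  show "\<exists>u v w. u \<noteq> v \<and> v \<noteq> w \<and> u \<noteq> w \<and> bd F = {{u, v}, {v, w}, {u, w}} \<and>
      {u, v} \<in> E \<and> {v, w} \<in> E \<and> {u, w} \<in> E"
    using bd uvw by blast
  have "h ` sphere 0 1 = (\<Union>e\<in>bd F. \<gamma> e ` {0..1})"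
    by (simp add: bd h(3) Un_assoc)
  then show "\<exists>h. homeomorphic_map (top_of_set (cball (0::real^2) 1)) (subtopology X (X closure_of F)) h \<and>
      h ` ball 0 1 = F \<and> h ` sphere 0 1 = (\<Union>e\<in>bd F. \<gamma> e ` {0..1})"
    using h(1,2) by blast
  show "e \<in> E \<Longrightarrow> x \<in> inner_arc e \<Longrightarrow> x \<in> X closure_of F \<Longrightarrow> e \<in> bd F"
    using inc bd by simp
qed

text \<open>Two faces with the same boundary would share three edges.\<close>

lemma bd_inj: "inj_on bd \<F>"
proof (rule inj_onI, rule ccontr)
  fix F F' assume F: "F \<in> \<F>" "F' \<in> \<F>" and eq: "bd F = bd F'" and ne: "F \<noteq> F'"
  obtain u v w where uvw: "u \<noteq> v" "v \<noteq> w" "u \<noteq> w" "bd F = {{u, v}, {v, w}, {u, w}}"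
    using face_triangle[OF F(1)] by blast
  have "{e \<in> E. \<gamma> e ` {0..1} \<subseteq> X closure_of F \<inter> X closure_of F'} = bd F"
    using eq by (auto simp: bd_def)
  then have "card (bd F) \<le> 1" using share[OF F ne] by simp
  moreover have "card (bd F) = 3" using uvw by (auto simp: card_insert_if doubleton_eq_iff)
  ultimately show False by simp
qed

lemma finite_faces: "finite \<F>"
proof (rule finite_imageD[OF _ bd_inj])
  have "bd ` \<F> \<subseteq> Pow E" by (auto simp: bd_def)
  then show "finite (bd ` \<F>)" using finite_E by (meson finite_Pow_iff finite_subset)
qed

section \<open>Counting the faces at an edge\<close>

text \<open>In the disc model of the face, the arc of \<open>e\<close> is pulled back to the circle
  and pushed radially inwards. The rectangle is closed only along the side \<open>y = 0\<close>,
  which parametrises the inner arc.\<close>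

lemma face_collar:
  assumes F: "F \<in> \<F>" and e: "e \<in> bd F"
  obtains k :: "real \<times> real \<Rightarrow> 'p" where
    "continuous_map (top_of_set ({0<..<1} \<times> {0..<1})) X k" "inj_on k ({0<..<1} \<times> {0..<1})"
    "\<And>x. 0 < x \<Longrightarrow> x < 1 \<Longrightarrow> k (x, 0) = \<gamma> e x"
    "\<And>x y. 0 < x \<Longrightarrow> x < 1 \<Longrightarrow> 0 < y \<Longrightarrow> y < 1 \<Longrightarrow> k (x, y) \<in> F"
proof -
  obtain h where
    h: "homeomorphic_map (top_of_set (cball (0::real^2) 1)) (subtopology X (X closure_of F)) h"
    "h ` ball 0 1 = F" "h ` sphere 0 1 = (\<Union>e\<in>bd F. \<gamma> e ` {0..1})"
    using face_disc[OF F] by blast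
  have top: "topspace (subtopology X (X closure_of F)) = X closure_of F"
    using closure_of_subset_topspace[of X F] by auto
  obtain h' where h': "homeomorphic_maps (top_of_set (cball (0::real^2) 1)) (subtopology X (X closure_of F)) h h'"
    using h(1) homeomorphic_map_maps by blast
  have eE: "e \<in> E" and ecl: "\<gamma> e ` {0..1} \<subseteq> X closure_of F" using e by (auto simp: bd_def)
  have hc: "continuous_map (top_of_set (cball 0 1)) X h"
    and h'c: "continuous_map (subtopology X (X closure_of F)) euclidean h'"
    and h'h: "\<And>z. norm z \<le> 1 \<Longrightarrow> h' (h z) = z" and hh': "\<And>x. x \<in> X closure_of F \<Longrightarrow> h (h' x) = x"
    using h' top by (auto simp: homeomorphic_maps_def continuous_map_in_subtopology)
  define \<alpha> where "\<alpha> = h' \<circ> \<gamma> e"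
  have \<gamma>cl: "\<gamma> e x \<in> X closure_of F" if "x \<in> {0..1}" for x using ecl that by blast
  have "continuous_map (top_of_set {0..1}) (subtopology X (X closure_of F)) (\<gamma> e)"
    using arc(1)[OF eE] \<gamma>cl by (auto simp: continuous_map_in_subtopology)
  then have \<alpha>c: "continuous_on {0..1} \<alpha>"
    using continuous_map_compose[OF _ h'c] unfolding \<alpha>_def by fastforce
  have h\<alpha>: "h (\<alpha> x) = \<gamma> e x" if "x \<in> {0..1}" for x using hh' \<gamma>cl that by (simp add: \<alpha>_def)
  have \<alpha>n: "norm (\<alpha> x) = 1" if "x \<in> {0..1}" for x
  proof -
    have "\<gamma> e x \<in> h ` sphere 0 1" using h(3) e that by blast
    then obtain z where z: "norm z = 1" "\<gamma> e x = h z" by auto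
    then show ?thesis using h'h[of z] by (simp add: \<alpha>_def)
  qed
  \<comment> \<open>The coordinate \<open>snd z\<close> is the depth below the circle; it stays
    below 1, so the centre is avoided and the map remains injective.\<close>
  define c where "c = (\<lambda>z::real\<times>real. (1 - snd z) *\<^sub>R \<alpha> (fst z))"
  let ?R = "{0<..<1} \<times> {0..<1} :: (real \<times> real) set"
  have cn: "norm (c z) = 1 - snd z" if "z \<in> ?R" for z
    using that \<alpha>n by (auto simp: c_def)
  have cc: "continuous_on ?R c"
    unfolding c_def by (intro continuous_intros continuous_on_compose2[OF \<alpha>c]) auto
  have "continuous_map (top_of_set ?R) (top_of_set (cball 0 1)) c"
    using cc cn by (auto simp: continuous_map_in_subtopology)
  then have k1: "continuous_map (top_of_set ?R) X (h \<circ> c)"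
    using continuous_map_compose[OF _ hc] by blast
  have k2: "inj_on (h \<circ> c) ?R"
  proof (rule inj_onI)
    fix z z' assume z: "z \<in> ?R" "z' \<in> ?R" and eq: "(h \<circ> c) z = (h \<circ> c) z'"
    have "norm (c z) \<le> 1" "norm (c z') \<le> 1" using cn[OF z(1)] cn[OF z(2)] z by auto
    then have "h' (h (c z)) = c z" "h' (h (c z')) = c z'" using h'h by blast+
    then have "c z = c z'" using eq by (metis comp_apply)
    then have s: "snd z = snd z'" using cn[OF z(1)] cn[OF z(2)] by simp
    then have "\<alpha> (fst z) = \<alpha> (fst z')" using \<open>c z = c z'\<close> z by (auto simp: c_def)
    then have "\<gamma> e (fst z) = \<gamma> e (fst z')" using h\<alpha>[of "fst z"] h\<alpha>[of "fst z'"] z by auto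
    then have "fst z = fst z'" using arc(2)[OF eE] z by (auto dest: inj_onD)
    then show "z = z'" using s by (simp add: prod_eq_iff)
  qed
  show ?thesis
  proof (rule that[OF k1 k2])
    show "(h \<circ> c) (x, 0) = \<gamma> e x" if "0 < x" "x < 1" for x using h\<alpha> that by (simp add: c_def)
    show "(h \<circ> c) (x, y) \<in> F" if "0 < x" "x < 1" "0 < y" "y < 1" for x y
      using h(2) cn[of "(x, y)"] that by auto
  qed
qed

text \<open>Two collars glued along the edge form a continuous injective image of an open rectangle,
  which is open by invariance of domain.\<close>

lemma two_faces_neighbourhood:
  assumes F1: "F1 \<in> \<F>" "e \<in> bd F1" and F2: "F2 \<in> \<F>" "e \<in> bd F2" and ne: "F1 \<noteq> F2"
  obtains N where "openin X N" "\<gamma> e (1/2) \<in> N" "N \<subseteq> F1 \<union> F2 \<union> inner_arc e"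
proof -
  let ?R = "{0<..<1} \<times> {0..<1} :: (real \<times> real) set"
  let ?W = "{0<..<1} \<times> {-1<..<1} :: (real \<times> real) set"
  obtain k1 where k1: "continuous_map (top_of_set ?R) X k1" "inj_on k1 ?R"
    "\<And>x. 0 < x \<Longrightarrow> x < 1 \<Longrightarrow> k1 (x, 0) = \<gamma> e x"
    "\<And>x y. 0 < x \<Longrightarrow> x < 1 \<Longrightarrow> 0 < y \<Longrightarrow> y < 1 \<Longrightarrow> k1 (x, y) \<in> F1"
    using face_collar[OF F1] by blast
  obtain k2 where k2: "continuous_map (top_of_set ?R) X k2" "inj_on k2 ?R"
    "\<And>x. 0 < x \<Longrightarrow> x < 1 \<Longrightarrow> k2 (x, 0) = \<gamma> e x"
    "\<And>x y. 0 < x \<Longrightarrow> x < 1 \<Longrightarrow> 0 < y \<Longrightarrow> y < 1 \<Longrightarrow> k2 (x, y) \<in> F2"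
    using face_collar[OF F2] by blast
  \<comment> \<open>The reflection puts the second collar into the lower half of the rectangle; on
    the line \<open>y = 0\<close> both collars equal \<open>\<gamma> e\<close>.\<close>
  define r where "r = (\<lambda>z::real\<times>real. (fst z, - snd z))"
  define g where "g = (\<lambda>z. if 0 \<le> snd z then k1 z else (k2 \<circ> r) z)"
  have e: "e \<in> E" using F1 by (simp add: bd_def)
  have "continuous_map (top_of_set ?W) X g"
    unfolding g_def
  proof (rule continuous_map_cases_le)
    show "continuous_map (subtopology (top_of_set ?W) {z \<in> topspace (top_of_set ?W). 0 \<le> snd z}) X k1"
      by (auto simp: subtopology_subtopology intro!: continuous_map_from_subtopology_mono[OF k1(1)])
    have "continuous_map (subtopology (top_of_set ?W) {z \<in> topspace (top_of_set ?W). snd z \<le> 0}) (top_of_set ?R) r"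
      by (auto simp: subtopology_subtopology continuous_map_in_subtopology r_def intro!: continuous_intros)
    then show "continuous_map (subtopology (top_of_set ?W) {z \<in> topspace (top_of_set ?W). snd z \<le> 0}) X (k2 \<circ> r)"
      using continuous_map_compose[OF _ k2(1)] by blast
    show "k1 z = (k2 \<circ> r) z" if "z \<in> topspace (top_of_set ?W)" "0 = snd z" for z
      using that k1(3) k2(3) by (cases z) (auto simp: r_def)
  qed (auto intro!: continuous_intros)
  moreover have upper: "g (x, y) = k1 (x, y)" if "0 \<le> y" for x y using that by (simp add: g_def)
  have lower: "g (x, y) = k2 (x, - y)" if "y < 0" for x y using that by (simp add: g_def r_def)
  have side: "(0 < y \<longrightarrow> g (x, y) \<in> F1) \<and> (y = 0 \<longrightarrow> g (x, y) \<in> inner_arc e) \<and> (y < 0 \<longrightarrow> g (x, y) \<in> F2)"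
    if "0 < x" "x < 1" "-1 < y" "y < 1" for x y
    using that k1(3,4) k2(4) by (auto simp: upper lower inner_arc_def)
  have disj: "F1 \<inter> F2 = {}" "F1 \<inter> inner_arc e = {}" "F2 \<inter> inner_arc e = {}"
    using face_disjoint[OF F1(1) F2(1) ne] face_inner_arc[OF F1(1) e] face_inner_arc[OF F2(1) e] .
  have below: "g (x, y) \<in> F2 \<longleftrightarrow> \<not> 0 \<le> y" if "0 < x" "x < 1" "-1 < y" "y < 1" for x y
    using side[OF that] disj by (cases y "0::real" rule: linorder_cases) auto
  have "inj_on g ?W"
  proof (rule inj_onI)
    fix z z' assume z: "z \<in> ?W" "z' \<in> ?W" and eq: "g z = g z'"
    obtain x y x' y' where xy: "z = (x, y)" "z' = (x', y')" by fastforce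
    \<comment> \<open>Membership of the value in \<open>F2\<close> tells the lower half from the
      rest, so a collision takes place within a single collar.\<close>
    have same: "0 \<le> y \<longleftrightarrow> 0 \<le> y'"
      using below[of x y] below[of x' y'] z eq by (auto simp: xy)
    show "z = z'"
    proof (cases "0 \<le> y")
      case True
      then have "k1 (x, y) = k1 (x', y')" using same eq upper by (simp add: xy)
      then show ?thesis using inj_onD[OF k1(2)] z True same by (auto simp: xy)
    next
      case False
      then have "k2 (x, - y) = k2 (x', - y')" using same eq lower by (simp add: xy)
      then show ?thesis using inj_onD[OF k2(2), of "(x, - y)" "(x', - y')"] z False same by (auto simp: xy)
    qed
  qed
  ultimately have "openin X (g ` ?W)"
    by (intro invariance_of_domain_into_surface[OF surface]) (auto intro: open_Times)
  moreover have "\<gamma> e (1/2) \<in> g ` ?W"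
    using k1(3)[of "1/2"] upper[of 0 "1/2"] by (intro image_eqI[of _ _ "(1/2, 0)"]) auto
  moreover have "g ` ?W \<subseteq> F1 \<union> F2 \<union> inner_arc e"
  proof clarify
    fix x y :: real assume "x \<in> {0<..<1}" "y \<in> {-1<..<1}" "g (x, y) \<notin> inner_arc e" "g (x, y) \<notin> F2"
    then show "g (x, y) \<in> F1"
      using side[of x y] by (cases y "0::real" rule: linorder_cases) auto
  qed
  ultimately show ?thesis using that by blast
qed

lemma edge_at_most_two_faces:
  assumes "e \<in> E"
  shows "card {F \<in> \<F>. e \<in> bd F} \<le> 2"
proof (rule ccontr)
  assume "\<not> ?thesis"
  then obtain T where T: "T \<subseteq> {F \<in> \<F>. e \<in> bd F}" "card T = 3"
    using obtain_subset_with_card_n[of 3] by (metis not_less_eq_eq numeral_3_eq_3 numeral_2_eq_2)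
  then obtain F1 F2 F3 where F: "T = {F1, F2, F3}" "F1 \<noteq> F2" "F1 \<noteq> F3" "F2 \<noteq> F3"
    by (auto simp: card_3_iff)
  then have F': "F1 \<in> \<F>" "e \<in> bd F1" "F2 \<in> \<F>" "e \<in> bd F2" "F3 \<in> \<F>" "e \<in> bd F3" using T by auto
  obtain N where N: "openin X N" "\<gamma> e (1/2) \<in> N" "N \<subseteq> F1 \<union> F2 \<union> inner_arc e"
    using two_faces_neighbourhood F F' by metis
  \<comment> \<open>A third face accumulates at the midpoint, hence meets \<open>N\<close>, although
    it is disjoint from everything that makes up \<open>N\<close>.\<close>
  have "\<gamma> e (1/2) \<in> X closure_of F3" using F'(6) by (auto simp: bd_def image_subset_iff)
  then obtain y where "y \<in> F3" "y \<in> N" using N by (auto simp: in_closure_of)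
  then show False
    using N(3) face_inner_arc[OF F'(5) assms] face_disjoint[OF F'(1,5) F(3)] face_disjoint[OF F'(3,5) F(4)]
    by blast
qed

text \<open>Otherwise the midpoint of the arc has a neighbourhood contained in the inner arc and at
  most one face. It then embeds in a line, or in a closed disc with the midpoint on the circle;
  \<open>surface_not_half_plane\<close> excludes both.\<close>

lemma edge_at_least_two_faces:
  assumes e: "e \<in> E"
  shows "card {F \<in> \<F>. e \<in> bd F} \<ge> 2"
proof (rule ccontr)
  assume "\<not> ?thesis"
  then have card: "card {F \<in> \<F>. e \<in> bd F} \<le> 1" by linarith
  define p where "p = \<gamma> e (1/2)"
  have p: "p \<in> inner_arc e" by (simp add: p_def inner_arc_def)
  have pX: "p \<in> topspace X" using arc_in_space[OF e] by (auto simp: p_def image_subset_iff)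
  \<comment> \<open>Everything away from the inner arc of \<open>e\<close> and the faces at
    \<open>e\<close>. It is closed as a finite union of closed sets, which uses the finiteness of
    the set of faces.\<close>
  define C where "C = \<phi> ` V \<union> (\<Union>e'\<in>E - {e}. \<gamma> e' ` {0..1}) \<union> (\<Union>F\<in>{F \<in> \<F>. e \<notin> bd F}. X closure_of F)"
  define N where "N = topspace X - C"
  have "finite V" using graph by (simp add: simple_graph_def)
  then have "closedin X (\<phi> ` V)"
    using embedding Hausdorff by (auto simp: graph_embedding_def intro!: closedin_Hausdorff_finite)
  then have "closedin X C"
    unfolding C_def using finite_E finite_faces closedin_arc by (intro closedin_Un closedin_Union) auto
  then have N: "openin X N" by (auto simp: N_def)
  \<comment> \<open>By \<open>inner_arc_in_bd\<close>, the closure of a face without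
    \<open>e\<close> on its boundary misses \<open>p\<close>.\<close>
  have pN: "p \<in> N"
    using pX p arc(4)[OF e] inner_arc_meets_arc[OF e _ p] inner_arc_in_bd[OF _ e p] by (auto simp: N_def C_def)
  have Nsub: "N \<subseteq> inner_arc e \<union> (\<Union>F\<in>{F \<in> \<F>. e \<in> bd F}. F)"
  proof
    fix x assume x: "x \<in> N"
    then have xC: "x \<in> topspace X" "x \<notin> \<phi> ` V" "\<And>e'. e' \<in> E \<Longrightarrow> x \<in> \<gamma> e' ` {0..1} \<Longrightarrow> e' = e"
      "\<And>F. F \<in> \<F> \<Longrightarrow> x \<in> X closure_of F \<Longrightarrow> e \<in> bd F"
      unfolding N_def C_def by blast+
    from covered[OF xC(1)] xC(2) consider e' where "e' \<in> E" "x \<in> \<gamma> e' ` {0..1}" | F where "F \<in> \<F>" "x \<in> F"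
      by blast
    then show "x \<in> inner_arc e \<union> (\<Union>F\<in>{F \<in> \<F>. e \<in> bd F}. F)"
    proof cases
      case 1
      then have "x \<in> inner_arc e \<union> \<phi> ` e" using xC(3) arc_eq[OF e] by blast
      then show ?thesis using xC(2) edge_sub_V[OF e] by blast
    next
      case 2
      then have "x \<in> X closure_of F" using closure_of_subset[OF face_sub(1)] by blast
      then show ?thesis using 2 xC(4) by blast
    qed
  qed
  show False
  proof (cases "{F \<in> \<F>. e \<in> bd F} = {}")
    case True
    \<comment> \<open>A continuous injection from a compact space into a Hausdorff space is a
      homeomorphism onto its image, so the arc parameter is continuous on the arc.\<close>
    have emb: "homeomorphic_map (top_of_set {0..1}) (subtopology X (\<gamma> e ` {0..1})) (\<gamma> e)"
      using arc[OF e] arc_in_space[OF e]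
      by (intro continuous_imp_homeomorphic_map)
         (auto simp: continuous_map_in_subtopology compact_space_subtopology Hausdorff_space_subtopology[OF Hausdorff])
    then obtain \<beta> where \<beta>: "homeomorphic_maps (top_of_set {0..1}) (subtopology X (\<gamma> e ` {0..1})) (\<gamma> e) \<beta>"
      using homeomorphic_map_maps by blast
    have NA: "N \<subseteq> \<gamma> e ` {0..1}" using Nsub arc_eq[OF e] by (simp only: True) blast
    have \<beta>c: "continuous_map (subtopology X N) euclideanreal \<beta>"
      using \<beta> NA by (auto simp: homeomorphic_maps_def continuous_map_in_subtopology intro: continuous_map_from_subtopology_mono)
    have "topspace (subtopology X (\<gamma> e ` {0..1})) = \<gamma> e ` {0..1}"
      using arc_in_space[OF e] by auto
    then have "\<gamma> e (\<beta> x) = x" if "x \<in> N" for x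
      using \<beta> NA that unfolding homeomorphic_maps_def by blast
    then have \<beta>inj: "inj_on \<beta> N"
      by (rule inj_on_inverseI)
    \<comment> \<open>The line is laid along the first axis; the second coordinate is then
      constantly 0 and so attains its maximum at \<open>p\<close>.\<close>
    define f where "f = (\<lambda>x. \<beta> x *\<^sub>R axis 1 1 :: real^2)"
    have "continuous_map (subtopology X N) euclidean f"
    proof -
      have "continuous_map euclideanreal euclidean (\<lambda>t. t *\<^sub>R axis 1 1 :: real^2)"
        by (auto intro!: continuous_intros)
      from continuous_map_compose[OF \<beta>c this] show ?thesis by (simp add: f_def o_def)
    qed
    moreover have "inj_on f N"
      using \<beta>inj by (auto simp: inj_on_def f_def)
    moreover have "axis 2 1 \<bullet> f x = (0::real)" for x by (simp add: f_def inner_axis_axis)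
    ultimately show False
      using surface_not_half_plane[OF surface N _ _ pN, of f "axis 2 1"] by (simp add: axis_eq_0_iff)
  next
    case False
    then obtain F where F: "F \<in> \<F>" "e \<in> bd F" by blast
    have "{F \<in> \<F>. e \<in> bd F} = {F}"
    proof -
      have "card {F} \<le> card {F \<in> \<F>. e \<in> bd F}" using F finite_faces by (intro card_mono) auto
      then show ?thesis using card F finite_faces card_subset_eq[of "{F \<in> \<F>. e \<in> bd F}" "{F}"] by simp
    qed
    then have NF: "N \<subseteq> inner_arc e \<union> F" using Nsub by auto
    obtain h where
      h: "homeomorphic_map (top_of_set (cball (0::real^2) 1)) (subtopology X (X closure_of F)) h"
      "h ` ball 0 1 = F"
      using face_disc[OF F(1)] by blast
    have top: "topspace (subtopology X (X closure_of F)) = X closure_of F"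
      using closure_of_subset_topspace[of X F] by auto
    obtain f where f: "homeomorphic_maps (top_of_set (cball (0::real^2) 1)) (subtopology X (X closure_of F)) h f"
      using h(1) homeomorphic_map_maps by blast
    have "inner_arc e \<subseteq> X closure_of F" using F(2) arc_eq[OF e] by (auto simp: bd_def)
    then have Ncl: "N \<subseteq> X closure_of F"
      using NF closure_of_subset[OF face_sub(1)[OF F(1)]] by blast
    have fc: "continuous_map (subtopology X N) euclidean f"
      using f Ncl by (auto simp: homeomorphic_maps_def continuous_map_in_subtopology intro: continuous_map_from_subtopology_mono)
    have hf: "h (f x) = x" "norm (f x) \<le> 1" if "x \<in> N" for x
      using f top Ncl that by (auto simp: homeomorphic_maps_def continuous_map_in_subtopology)
    have "inj_on f N" using hf by (metis inj_onI)
    have "p \<notin> F" using p face_inner_arc[OF F(1) e] by blast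
    then have "f p \<notin> ball 0 1" using h(2) hf(1)[OF pN] by (metis image_eqI)
    then have fp: "norm (f p) = 1" using hf(2)[OF pN] by simp
    \<comment> \<open>The tangent to the unit circle at \<open>f p\<close> supports the disc, so
      \<open>f p\<close> itself serves as the linear functional.\<close>
    have "f p \<bullet> f x \<le> f p \<bullet> f p" if "x \<in> N" for x
      using norm_cauchy_schwarz[of "f p" "f x"] hf(2)[OF that] fp by (simp add: dot_square_norm)
    moreover have "f p \<noteq> 0" using fp by auto
    ultimately show False
      using surface_not_half_plane[OF surface N fc \<open>inj_on f N\<close> pN] by blast
  qed
qed

section \<open>From faces to combinatorial triangles\<close>

lemma edge_two_faces: "e \<in> E \<Longrightarrow> card {F \<in> \<F>. e \<in> bd F} = 2"
  by (rule le_antisym[OF edge_at_most_two_faces edge_at_least_two_faces])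

text \<open>Replaces each face by the set of its three corners, which leaves a purely combinatorial
  statement for \<open>triangles_colour_degree\<close>. The count survives because distinct faces
  have distinct corner sets.\<close>

lemma edge_two_triangles:
  obtains \<T> where "finite \<T>"
    "\<And>T. T \<in> \<T> \<Longrightarrow> \<exists>u v w. u \<noteq> v \<and> v \<noteq> w \<and> u \<noteq> w \<and> T = {u, v, w} \<and>
       {u, v} \<in> E \<and> {v, w} \<in> E \<and> {u, w} \<in> E"
    "\<And>e. e \<in> E \<Longrightarrow> card {T \<in> \<T>. e \<subseteq> T} = 2"
proof -
  define t where "t F = \<Union>(bd F)" for F
  have tri: "\<exists>u v w. u \<noteq> v \<and> v \<noteq> w \<and> u \<noteq> w \<and> t F = {u, v, w} \<and>
       {u, v} \<in> E \<and> {v, w} \<in> E \<and> {u, w} \<in> E \<and> bd F = {{u, v}, {v, w}, {u, w}}" if F: "F \<in> \<F>" for F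
  proof -
    obtain u v w where uvw: "u \<noteq> v \<and> v \<noteq> w \<and> u \<noteq> w \<and> bd F = {{u, v}, {v, w}, {u, w}} \<and>
      {u, v} \<in> E \<and> {v, w} \<in> E \<and> {u, w} \<in> E"
      using face_triangle[OF F] by (elim exE) (rule that)
    then have "t F = {u, v, w}" by (auto simp: t_def)
    then show ?thesis using uvw by (intro exI[of _ u] exI[of _ v] exI[of _ w]) simp
  qed
  \<comment> \<open>The boundary is recovered from the corners: an edge within a set of three
    vertices is one of its sides. Injectivity of \<open>t\<close> thus follows from that of
    \<open>bd\<close>.\<close>
  have bd: "bd F = {e \<in> E. e \<subseteq> t F}" if F: "F \<in> \<F>" for F
  proof -
    obtain u v w where uvw: "t F = {u, v, w}" "bd F = {{u, v}, {v, w}, {u, w}}"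
      using tri[OF F] by blast
    have "e \<in> bd F" if e: "e \<in> E" "e \<subseteq> t F" for e
    proof -
      obtain a b where "e = {a, b}" "a \<noteq> b" using graph e by (auto simp: simple_graph_def)
      then show ?thesis using e uvw by auto
    qed
    then show ?thesis by (auto simp: bd_def t_def)
  qed
  have inj: "inj_on t \<F>" using bd by (intro inj_onI inj_onD[OF bd_inj]) auto
  show ?thesis
  proof (rule that[of "t ` \<F>"])
    show "finite (t ` \<F>)" using finite_faces by simp
    show "\<exists>u v w. u \<noteq> v \<and> v \<noteq> w \<and> u \<noteq> w \<and> T = {u, v, w} \<and>
       {u, v} \<in> E \<and> {v, w} \<in> E \<and> {u, w} \<in> E" if T: "T \<in> t ` \<F>" for T
    proof -
      obtain F where F: "F \<in> \<F>" "T = t F" using T by (rule imageE)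
      show ?thesis
        using tri[OF F(1)] unfolding F(2) by (elim exE, intro exI conjI) (elim conjE, assumption)+
    qed
    show "card {T \<in> t ` \<F>. e \<subseteq> T} = 2" if e: "e \<in> E" for e
    proof -
      have "{T \<in> t ` \<F>. e \<subseteq> T} = t ` {F \<in> \<F>. e \<in> bd F}" using bd e by auto
      moreover have "inj_on t {F \<in> \<F>. e \<in> bd F}" using inj by (rule inj_on_subset) auto
      ultimately show ?thesis using edge_two_faces[OF e] by (simp add: card_image)
    qed
  qed
qed

end


section \<open>The theorem\<close>

theorem theorem1p2:
  fixes X :: "'p topology" and V :: "'v set" and E :: "'v set set"
  assumes "closed_surface X"
    and "simple_graph V E" and "connected_graph V E"
    and "triangulation_of X V E"
    and "chromatic_number V E = 3"
    and "eulerian V E"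
    and "deg_cong_count 4 2 V E = 0"
  shows "\<forall>s\<in>V. wins_feedback_game E s Bob"
proof
  fix s assume s: "s \<in> V"
  obtain \<phi> \<gamma> where emb: "graph_embedding X V E \<phi> \<gamma>"
    and tri: "\<forall>F\<in>faces X V E \<phi> \<gamma>. triangular_face X E \<gamma> F"
    and share: "\<forall>F\<in>faces X V E \<phi> \<gamma>. \<forall>F'\<in>faces X V E \<phi> \<gamma>. F \<noteq> F' \<longrightarrow>
       card {e \<in> E. \<gamma> e ` {0..1} \<subseteq> X closure_of F \<inter> X closure_of F'} \<le> 1"
    using assms(4) unfolding triangulation_of_def by (elim exE conjE)
  interpret surface_triangulation X V E \<phi> \<gamma>
    by unfold_locales (fact assms(1), fact assms(2), fact emb, rule tri[rule_format], assumption,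
      rule share[rule_format], assumption+)
  obtain \<T> where \<T>: "finite \<T>"
    "\<And>T. T \<in> \<T> \<Longrightarrow> \<exists>u v w. u \<noteq> v \<and> v \<noteq> w \<and> u \<noteq> w \<and> T = {u, v, w} \<and>
       {u, v} \<in> E \<and> {v, w} \<in> E \<and> {u, w} \<in> E"
    "\<And>e. e \<in> E \<Longrightarrow> card {T \<in> \<T>. e \<subseteq> T} = 2"
    by (rule edge_two_triangles) (rule that, assumption+)
  obtain c where c: "proper_coloring V E 3 c"
    using chromatic_number_colouring[OF assms(2)] assms(5) by auto
  obtain t where t: "{s, t} \<in> E"
    using connected_has_edge_at[OF assms(2,3) _ s] assms(5) by auto
  have "finite V" using assms(2) by (simp add: simple_graph_def)
  then have deg4: "4 dvd degree E v" if "v \<in> V" for v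
  proof -
    \<comment> \<open>A cardinality of 0 means an empty set here because \<open>V\<close> is finite;
      evenness of the degree then leaves only the residue 0.\<close>
    have "degree E v mod 4 \<noteq> 2"
      using assms(7) that \<open>finite V\<close> by (auto simp: deg_cong_count_def)
    moreover have "even (degree E v)" using assms(6) that by (simp add: eulerian_def)
    ultimately show ?thesis by presburger
  qed
  show "wins_feedback_game E s Bob"
  proof (rule Bob_wins_by_colour_class[OF assms(2) t, where c = c])
    show "c v \<noteq> c s" if uv: "{u, v} \<in> E" "c u = c s" for u v
    proof -
      have "u \<in> V" "v \<in> V" using simple_graph_edgeD[OF assms(2) uv(1)] by blast+
      then have "c u \<noteq> c v" using c uv(1) unfolding proper_coloring_def by blast
      then show ?thesis using uv(2) by simp
    qed
    show "even (card {e \<in> E. v \<in> e \<and> (\<exists>u\<in>e. c u = c s)})" if v: "v \<in> V" "c v \<noteq> c s" for v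
    proof -
      have "c s < 3" using c s by (simp add: proper_coloring_def)
      \<comment> \<open>Twice the required count is a multiple of 4, so the count is even.\<close>
      then have "2 * card {e \<in> E. v \<in> e \<and> (\<exists>u\<in>e. c u = c s)} = degree E v"
        using triangles_colour_degree[OF assms(2) \<T> c v(1) _ v(2)] by blast
      then show ?thesis using deg4[OF v(1)] by presburger
    qed
  qed
qed

end
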